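(* Let $X,Y$ be measurable spaces and let $\nu,\nu'$ be s-finite kernels from $X$ to $Y$ such that $\nu'\stackrel{\infty}{\ll}\nu$. Then there exists a function $f:X\times Y\to[0,\infty]$ such that $f(x,-)$ is measurable on $Y$ for all $x\in X$, and $\nu'=\nu\triangleright f$. If $X$ is countable and discrete or $Y$ is standard Borel, then $f$ can be taken to be jointly measurable on $X\times Y$. The existence statement can fail if the hypothesis $\nu'\stackrel{\infty}{\ll}\nu$ is weakened to $\nu'\ll\nu$: there exist measurable spaces $X,Y$ and s-finite kernels $\nu,\nu'$ from $X$ to $Y$ with $\nu'\ll\nu$ for which there is no function $f:X\times Y\to[0,\infty]$ with $f(x,-)$ measurable on $Y$ for all $x\in X$ and $\nu'=\nu\triangleright f$.
   Context: A kernel from a measurable space $X$ to a measurable space $Y$ is a map $k:X\times\Sigma_Y\to[0,\infty]$ that is measurable in its first argument and a measure in its second; $k(x)$ denotes the measure $k(x,-)$. It is finite if $\sup_{x\in X}k(x,Y)<\infty$, and s-finite if $k=\sum_{i\in\mathbb{N}}k_i$ with each $k_i$ a finite kernel from $X$ to $Y$. For $f:X\times Y\to[0,\infty]$ with each $f(x,-)$ measurable, $(k\triangleright f)(x,V):=\int_V k(x,\mathrm{d}y)\,f(x,y)$. Convention: $\infty\cdot 0=0$. Given a measure $m$ on $Y$, a set $U\in\Sigma_Y$ is an $m$-$0$-$\infty$-set if every measurable $V\subseteq U$ satisfies $m(V)\in\{0,\infty\}$. For kernels $\nu,\nu'$ from $X$ to $Y$: $\nu'\ll\nu$ means that for all $x\in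 X$ every $\nu(x)$-null set is $\nu'(x)$-null; $\nu'\stackrel{\infty}{\ll}\nu$ means that $\nu'\ll\nu$ and, for all $x\in X$, every $\nu(x)$-$0$-$\infty$-set is a $\nu'(x)$-$0$-$\infty$-set. A countable discrete space carries the $\sigma$-algebra of all subsets; a standard Borel space is a set with the Borel $\sigma$-algebra of some complete separable metric. *)

theory Defs
  imports "HOL-Analysis.Analysis"
begin

text \<open>A kernel assigns a measure to each point of the source; its values outside
  \<open>space X\<close> are irrelevant.\<close>

definition kernel :: "'a measure \<Rightarrow> 'b measure \<Rightarrow> ('a \<Rightarrow> 'b measure) \<Rightarrow> bool" where
  "kernel X Y k \<longleftrightarrow>
     (\<forall>x\<in>space X. sets (k x) = sets Y) \<and>
     (\<forall>V\<in>sets Y. (\<lambda>x. emeasure (k x) V) \<in> borel_measurable X)"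

definition finite_kernel :: "'a measure \<Rightarrow> 'b measure \<Rightarrow> ('a \<Rightarrow> 'b measure) \<Rightarrow> bool" where
  "finite_kernel X Y k \<longleftrightarrow>
     kernel X Y k \<and> (SUP x\<in>space X. emeasure (k x) (space Y)) < \<infinity>"

definition s_finite_kernel :: "'a measure \<Rightarrow> 'b measure \<Rightarrow> ('a \<Rightarrow> 'b measure) \<Rightarrow> bool" where
  "s_finite_kernel X Y k \<longleftrightarrow>
     kernel X Y k \<and>
     (\<exists>ki :: nat \<Rightarrow> 'a \<Rightarrow> 'b measure.
        (\<forall>i. finite_kernel X Y (ki i)) \<and>
        (\<forall>x\<in>space X. \<forall>V\<in>sets Y. emeasure (k x) V = (\<Sum>i. emeasure (ki i x) V)))"

definition kernel_density :: "('a \<Rightarrow> 'b measure) \<Rightarrow> ('a \<times> 'b \<Rightarrow> ennreal) \<Rightarrow> 'a \<Rightarrow> 'b measure" where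
  "kernel_density k f x = density (k x) (\<lambda>y. f (x, y))"

text \<open>The defining formula of the density kernel. The product in \<^typ>\<open>ennreal\<close> satisfies
  \<open>\<infinity> * 0 = 0\<close>.\<close>

lemma emeasure_kernel_density:
  assumes "kernel X Y k" "x \<in> space X" "(\<lambda>y. f (x, y)) \<in> borel_measurable Y" "V \<in> sets Y"
  shows "emeasure (kernel_density k f x) V = (\<integral>\<^sup>+y\<in>V. f (x, y) \<partial>k x)"
proof -
  have s: "sets (k x) = sets Y"
    using assms by (auto simp: kernel_def)
  then show ?thesis
    using assms by (simp add: kernel_density_def emeasure_density cong: measurable_cong_sets)
qed

definition zero_infty_set :: "'b measure \<Rightarrow> 'b set \<Rightarrow> bool" where
  "zero_infty_set m U \<longleftrightarrow>
     U \<in> sets m \<and> (\<forall>V\<in>sets m. V \<subseteq> U \<longrightarrow> emeasure m V \<in> {0, \<infinity>})"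

text \<open>The dominated kernel comes first, as in \<open>\<nu>' \<lless> \<nu>\<close>, whereas the library's
  \<^const>\<open>absolutely_continuous\<close> takes the dominating measure first.\<close>

definition kernel_ac :: "'a measure \<Rightarrow> ('a \<Rightarrow> 'b measure) \<Rightarrow> ('a \<Rightarrow> 'b measure) \<Rightarrow> bool" where
  "kernel_ac X \<nu>' \<nu> \<longleftrightarrow> (\<forall>x\<in>space X. absolutely_continuous (\<nu> x) (\<nu>' x))"

definition kernel_infty_ac :: "'a measure \<Rightarrow> ('a \<Rightarrow> 'b measure) \<Rightarrow> ('a \<Rightarrow> 'b measure) \<Rightarrow> bool" where
  "kernel_infty_ac X \<nu>' \<nu> \<longleftrightarrow>
     kernel_ac X \<nu>' \<nu> \<and>
     (\<forall>x\<in>space X. \<forall>U. zero_infty_set (\<nu> x) U \<longrightarrow> zero_infty_set (\<nu>' x) U)"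

definition countable_discrete :: "'a measure \<Rightarrow> bool" where
  "countable_discrete X \<longleftrightarrow> countable (space X) \<and> sets X = Pow (space X)"

definition standard_borel :: "'b measure \<Rightarrow> bool" where
  "standard_borel Y \<longleftrightarrow>
     (\<exists>d. Metric_space (space Y) d \<and>
          Metric_space.mcomplete (space Y) d \<and>
          separable_space (Metric_space.mtopology (space Y) d) \<and>
          sets Y = sigma_sets (space Y) {U. openin (Metric_space.mtopology (space Y) d) U})"

end

theory Submission
  imports Defs
begin

text \<open>
  Every s-finite kernel is the density, with values in \<open>[0, \<infinity>]\<close>, of a kernel of finite
  measures with the same null sets. Taking \<open>\<nu> = g \<mu>\<close> and \<open>\<nu>' = h \<mu>\<close> for the same \<open>\<mu>\<close>, the density
  of \<open>\<nu>'\<close> with respect to \<open>\<nu>\<close> is \<open>h / g\<close> where \<open>g < \<infinity>\<close>, and \<open>h\<close> itself where \<open>g = \<infinity>\<close>: the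
  latter set is a \<open>\<nu>\<close>-0-\<open>\<infinity>\<close>-set, hence a \<open>\<nu>'\<close>-0-\<open>\<infinity>\<close>-set, so \<open>h\<close> takes only the
  values \<open>0\<close> and \<open>\<infinity>\<close> on it.

  Sectionwise measurability is the case of a one-point \<open>X\<close>. Joint measurability reduces to
  kernels \<open>\<kappa> \<lless> \<mu>\<close> of finite measures. If \<open>Y\<close> is generated by a countable
  ring of sets, then for rational \<open>q\<close> the set \<open>{d\<kappa>/d\<mu> > q}\<close> maximises \<open>\<kappa> - q \<mu>\<close>. Choose for each
  \<open>k\<close> the first ring element that is \<open>2\<^sup>-\<^sup>k\<close>-optimal, which depends measurably on \<open>x\<close>; by
  Borel--Cantelli these sets converge almost everywhere to \<open>{d\<kappa>/d\<mu> > q}\<close> off \<open>{d\<kappa>/d\<mu> = q}\<close>.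

  Without the condition on 0-\<open>\<infinity>\<close>-sets, an atom of infinite \<open>\<nu>\<close>-mass and \<open>\<nu>'\<close>-mass \<open>1\<close> is
  a counterexample.
\<close>

section \<open>Approximation by rings of sets in finite measure spaces\<close>

text \<open>The approximable sets contain \<open>A\<close> and form a sigma-algebra: passing to
  complements preserves symmetric differences, and continuity from below reduces countable unions to
  finite ones.\<close>

lemma (in finite_measure) approximation_by_set_ring:
  assumes sets: "sets M = sigma_sets (space M) A" and space: "space M \<in> A"
    and Un: "\<And>a b. a \<in> A \<Longrightarrow> b \<in> A \<Longrightarrow> a \<union> b \<in> A"
    and Diff: "\<And>a b. a \<in> A \<Longrightarrow> b \<in> A \<Longrightarrow> a - b \<in> A"
    and B: "B \<in> sets M" and e: "e > 0"
  shows "\<exists>C\<in>A. measure M (sym_diff B C) < e"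
proof -
  have sub: "a \<in> sets M" if "a \<in> A" for a
    using that by (auto simp: sets)
  have "B \<in> sigma_sets (space M) A" using B sets by simp
  then have "\<forall>e>0. \<exists>C\<in>A. measure M (sym_diff B C) < e"
  proof (induction rule: sigma_sets.induct)
    case (Basic a)
    then show ?case by (intro allI impI bexI[of _ a]) auto
  next
    case Empty
    have "{} \<in> A" using Diff[OF space space] by simp
    then show ?case by (intro allI impI bexI[of _ "{}"]) auto
  next
    case (Compl a)
    show ?case
    proof (intro allI impI)
      fix e :: real assume "e > 0"
      then obtain C where C: "C \<in> A" "measure M (sym_diff a C) < e"
        using Compl.IH by blast
      have "a \<in> sets M" using Compl.hyps sets by simp
      then have "a \<subseteq> space M" by (rule sets.sets_into_space)
      moreover have "C \<subseteq> space M" using sub[OF C(1)] by (rule sets.sets_into_space)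
      ultimately have "sym_diff (space M - a) (space M - C) = sym_diff a C" by blast
      then show "\<exists>C\<in>A. measure M (sym_diff (space M - a) C) < e"
        using Diff[OF space C(1)] C(2) by metis
    qed
  next
    case (Union a)
    have a: "a i \<in> sets M" for i using Union.hyps sets by simp
    let ?U = "\<lambda>n. \<Union>i<n. a i"
    have fin: "\<forall>e>0. \<exists>C\<in>A. measure M (sym_diff (?U n) C) < e" for n
    proof (induction n)
      case 0
      have "{} \<in> A" using Diff[OF space space] by simp
      then show ?case by (intro allI impI bexI[of _ "{}"]) auto
    next
      case (Suc n)
      show ?case
      proof (intro allI impI)
        fix e :: real assume "e > 0"
        then obtain C D where C: "C \<in> A" "measure M (sym_diff (?U n) C) < e / 2"
          and D: "D \<in> A" "measure M (sym_diff (a n) D) < e / 2"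
          using Suc.IH Union.IH[of n] half_gt_zero by metis
        note [measurable] = sub[OF C(1)] sub[OF D(1)] a
        have "measure M (sym_diff (?U (Suc n)) (C \<union> D))
            \<le> measure M (sym_diff (?U n) C \<union> sym_diff (a n) D)"
          by (rule finite_measure_mono) (auto simp: lessThan_Suc)
        also have "\<dots> \<le> measure M (sym_diff (?U n) C) + measure M (sym_diff (a n) D)"
          by (rule measure_Un_le) auto
        also have "\<dots> < e" using C D by simp
        finally show "\<exists>C\<in>A. measure M (sym_diff (?U (Suc n)) C) < e"
          using Un[OF C(1) D(1)] by blast
      qed
    qed
    show ?case
    proof (intro allI impI)
      fix e :: real assume e: "e > 0"
      \<comment> \<open>The union is truncated where less than \<open>e / 2\<close> of its measure
        is lost; the other half pays for approximating the finite union.\<close>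
      have "(\<lambda>n. measure M (?U n)) \<longlonglongrightarrow> measure M (\<Union>n. ?U n)"
        by (rule finite_Lim_measure_incseq) (use a in \<open>auto simp: incseq_def intro: less_le_trans\<close>)
      moreover have eq: "(\<Union>n. ?U n) = (\<Union>i. a i)" by auto
      ultimately have "\<forall>\<^sub>F n in sequentially. measure M (\<Union>i. a i) - e / 2 < measure M (?U n)"
        using e by (intro order_tendstoD(1)) auto
      then obtain n where n: "measure M (\<Union>i. a i) - e / 2 < measure M (?U n)"
        by (auto simp: eventually_sequentially)
      obtain C where C: "C \<in> A" "measure M (sym_diff (?U n) C) < e / 2"
        using fin[of n] e half_gt_zero by metis
      note [measurable] = sub[OF C(1)] a
      have "measure M (sym_diff (\<Union>i. a i) C)
          \<le> measure M (((\<Union>i. a i) - ?U n) \<union> sym_diff (?U n) C)"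
        by (rule finite_measure_mono) auto
      also have "\<dots> \<le> measure M ((\<Union>i. a i) - ?U n) + measure M (sym_diff (?U n) C)"
        by (rule measure_Un_le) auto
      also have "measure M ((\<Union>i. a i) - ?U n) = measure M (\<Union>i. a i) - measure M (?U n)"
        by (rule finite_measure_Diff) auto
      finally show "\<exists>C\<in>A. measure M (sym_diff (\<Union>i. a i) C) < e"
        using C n by (intro bexI[of _ C]) auto
    qed
  qed
  then show ?thesis using e by blast
qed

text \<open>The set \<open>{h > q}\<close> maximises the integral of \<open>h - q\<close>, and the
  deficit of any other set is its distance from \<open>{h > q}\<close> under the measure with
  density \<open>\<bar>h - q\<bar>\<close>. Near-optimality thus makes these distances summable, and
  Borel--Cantelli applies. The new measure does not see \<open>{h = q}\<close>, hence the exception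
  there.\<close>

lemma (in finite_measure) AE_near_optimal_sets:
  fixes h :: "'a \<Rightarrow> real" and q :: real and a E :: "nat \<Rightarrow> 'a set"
  assumes int: "integrable M h"
    and sets: "sets M = sigma_sets (space M) (range a)" and space: "space M \<in> range a"
    and Un: "\<And>b c. b \<in> range a \<Longrightarrow> c \<in> range a \<Longrightarrow> b \<union> c \<in> range a"
    and Diff: "\<And>b c. b \<in> range a \<Longrightarrow> c \<in> range a \<Longrightarrow> b - c \<in> range a"
    and E[measurable]: "\<And>k. E k \<in> sets M"
    and opt: "\<And>k i. (LINT x:a i|M. h x - q) < (LINT x:E k|M. h x - q) + (1/2)^k"
  shows "AE x in M. h x \<noteq> q \<longrightarrow> (\<forall>\<^sub>F k in sequentially. x \<in> E k \<longleftrightarrow> q < h x)"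
proof -
  define B where "B = {x \<in> space M. q < h x}"
  define M' where "M' = density M (\<lambda>x. ennreal \<bar>h x - q\<bar>)"
  let ?s = "\<lambda>E. LINT x:E|M. h x - q"
  note [measurable] = borel_measurable_integrable[OF int]
  have a[measurable]: "a i \<in> sets M" for i unfolding sets by blast
  have B[measurable]: "B \<in> sets M" unfolding B_def by measurable
  have int': "integrable M (\<lambda>x. h x - q)" using int by simp
  have em: "emeasure M' S = ennreal (\<integral>x. \<bar>h x - q\<bar> * indicator S x \<partial>M)" if [measurable]: "S \<in> sets M" for S
  proof -
    have "emeasure M' S = (\<integral>\<^sup>+x. ennreal (\<bar>h x - q\<bar> * indicator S x) \<partial>M)"
      unfolding M'_def by (subst emeasure_density) (auto simp: ennreal_mult' ennreal_indicator)
    also have "\<dots> = ennreal (\<integral>x. \<bar>h x - q\<bar> * indicator S x \<partial>M)"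
      using int' by (intro nn_integral_eq_integral integrable_real_mult_indicator) auto
    finally show ?thesis .
  qed
  have m: "measure M' (sym_diff B S) = ?s B - ?s S" if [measurable]: "S \<in> sets M" for S
  proof -
    have "measure M' (sym_diff B S) = (\<integral>x. \<bar>h x - q\<bar> * indicator (sym_diff B S) x \<partial>M)"
      by (auto simp: measure_def em)
    \<comment> \<open>\<open>h - q\<close> is positive on \<open>B\<close> and nonpositive off it,
      so the difference of the two integrands has the right sign on both halves of
      \<open>sym_diff B S\<close>.\<close>
    also have "\<dots> = (\<integral>x. indicator B x *\<^sub>R (h x - q) - indicator S x *\<^sub>R (h x - q) \<partial>M)"
      by (rule Bochner_Integration.integral_cong) (auto simp: B_def indicator_def split: if_splits)
    also have "\<dots> = ?s B - ?s S"
      unfolding set_lebesgue_integral_def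
      by (intro Bochner_Integration.integral_diff integrable_mult_indicator int') auto
    finally show ?thesis .
  qed
  have setsM': "sets M' = sets M" "space M' = space M" by (auto simp: M'_def)
  interpret M': finite_measure M'
    by (rule finite_measureI) (use em[OF sets.top] in \<open>simp add: setsM'\<close>)
  \<comment> \<open>\<open>opt\<close> compares \<open>E k\<close> only with the sets
    \<open>a i\<close>, and \<open>B\<close> need not be one of them. Approximating \<open>B\<close>
    by some \<open>a i\<close> costs an arbitrarily small \<open>e\<close>.\<close>
  have bound: "measure M' (sym_diff B (E k)) \<le> (1/2)^k" for k
  proof (rule field_le_epsilon)
    fix e :: real assume "e > 0"
    with M'.approximation_by_set_ring[of "range a" B e] sets space Un Diff
    obtain C where "C \<in> range a" "measure M' (sym_diff B C) < e"
      using B setsM' by metis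
    then obtain i where "measure M' (sym_diff B (a i)) < e" by blast
    then show "measure M' (sym_diff B (E k)) \<le> (1/2)^k + e"
      using opt[of i k] by (simp add: m)
  qed
  have "AE x in M'. \<forall>\<^sub>F k in sequentially. x \<in> space M' - sym_diff B (E k)"
  proof (rule borel_cantelli_AE1)
    show "summable (\<lambda>k. measure M' (sym_diff B (E k)))"
      by (rule summable_comparison_test[OF _ summable_geometric[of "1/2"]]) (use bound in auto)
  qed (auto simp: setsM' less_top[symmetric])
  then have "AE x in M. 0 < ennreal \<bar>h x - q\<bar> \<longrightarrow>
      (\<forall>\<^sub>F k in sequentially. x \<in> space M' - sym_diff B (E k))"
    unfolding M'_def by (subst (asm) AE_density) (auto simp: M'_def)
  with AE_space show ?thesis
  proof eventually_elim
    case (elim x)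
    show ?case
    proof
      assume "h x \<noteq> q"
      with elim have "\<forall>\<^sub>F k in sequentially. x \<in> space M' - sym_diff B (E k)" by simp
      then show "\<forall>\<^sub>F k in sequentially. x \<in> E k \<longleftrightarrow> q < h x"
        by eventually_elim (use elim in \<open>auto simp: B_def\<close>)
    qed
  qed
qed

section \<open>Countable rings of sets\<close>

text \<open>Closing up in stages makes countability of the generated ring a plain induction.\<close>

primrec set_ring_stage :: "'a set set \<Rightarrow> nat \<Rightarrow> 'a set set" where
  "set_ring_stage G 0 = G"
| "set_ring_stage G (Suc n) = set_ring_stage G n
     \<union> (\<lambda>(a, b). a \<union> b) ` (set_ring_stage G n \<times> set_ring_stage G n)
     \<union> (\<lambda>(a, b). a - b) ` (set_ring_stage G n \<times> set_ring_stage G n)"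

lemma countable_set_ring_hull:
  assumes "countable G" "G \<subseteq> sets M"
  obtains A where "countable A" "G \<subseteq> A" "A \<subseteq> sets M"
    "\<And>a b. a \<in> A \<Longrightarrow> b \<in> A \<Longrightarrow> a \<union> b \<in> A" "\<And>a b. a \<in> A \<Longrightarrow> b \<in> A \<Longrightarrow> a - b \<in> A"
proof
  let ?A = "\<Union>n. set_ring_stage G n"
  have "countable (set_ring_stage G n)" for n using assms by (induction n) auto
  then show "countable ?A" by auto
  show "G \<subseteq> ?A" using set_ring_stage.simps(1)[of G] by blast
  have "set_ring_stage G n \<subseteq> sets M" for n using assms by (induction n) auto
  then show "?A \<subseteq> sets M" by blast
  \<comment> \<open>Since the stages increase, any two elements of the hull lie in a common
    stage.\<close>
  have mono: "set_ring_stage G m \<subseteq> set_ring_stage G n" if "m \<le> n" for m n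
    using that by (rule lift_Suc_mono_le[rotated]) auto
  have *: "a \<union> b \<in> ?A \<and> a - b \<in> ?A" if ab: "a \<in> ?A" "b \<in> ?A" for a b
  proof -
    obtain m n where mn: "a \<in> set_ring_stage G m" "b \<in> set_ring_stage G n" using ab by blast
    then have "(a, b) \<in> set_ring_stage G (max m n) \<times> set_ring_stage G (max m n)"
      using mono[of m "max m n"] mono[of n "max m n"] by auto
    then have "a \<union> b \<in> set_ring_stage G (Suc (max m n))" "a - b \<in> set_ring_stage G (Suc (max m n))"
      by force+
    then show ?thesis by blast
  qed
  show "a \<union> b \<in> ?A" "a - b \<in> ?A" if "a \<in> ?A" "b \<in> ?A" for a b using *[OF that] by auto
qed

section \<open>Jointly measurable derivatives for kernels of finite measures\<close>

lemma kernelD: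
  assumes "kernel X Y k"
  shows "x \<in> space X \<Longrightarrow> sets (k x) = sets Y" "x \<in> space X \<Longrightarrow> space (k x) = space Y"
    "V \<in> sets Y \<Longrightarrow> (\<lambda>x. emeasure (k x) V) \<in> borel_measurable X"
  using assms by (auto simp: kernel_def dest: sets_eq_imp_space_eq)

text \<open>Derivatives chosen separately for each \<open>x\<close> need not depend measurably on
  \<open>x\<close>. The function \<open>g\<close> is therefore built from the masses of countably
  many sets \<open>a j\<close> alone; the fibrewise derivative \<open>h\<close> enters only to
  verify it.\<close>

lemma pair_Radon_Nikodym_countably_generated:
  fixes X :: "'a measure" and Y :: "'b measure" and G :: "'b set set"
  assumes G: "countable G" "sets Y = sigma_sets (space Y) G"
    and \<mu>: "kernel X Y \<mu>" "\<And>x. x \<in> space X \<Longrightarrow> finite_measure (\<mu> x)"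
    and \<kappa>: "kernel X Y \<kappa>" "\<And>x. x \<in> space X \<Longrightarrow> finite_measure (\<kappa> x)"
    and ac: "\<And>x. x \<in> space X \<Longrightarrow> absolutely_continuous (\<mu> x) (\<kappa> x)"
  shows "\<exists>g\<in>borel_measurable (X \<Otimes>\<^sub>M Y). \<forall>x\<in>space X. density (\<mu> x) (\<lambda>y. g (x, y)) = \<kappa> x"
proof -
  have G': "insert (space Y) G \<subseteq> sets Y" using G(2) by auto
  obtain A where A: "countable A" "insert (space Y) G \<subseteq> A" "A \<subseteq> sets Y"
    and Un: "\<And>b c. b \<in> A \<Longrightarrow> c \<in> A \<Longrightarrow> b \<union> c \<in> A"
    and Diff: "\<And>b c. b \<in> A \<Longrightarrow> c \<in> A \<Longrightarrow> b - c \<in> A"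
    using countable_set_ring_hull[OF _ G'] G(1) by (metis countable_insert)
  have genA: "sets Y = sigma_sets (space Y) A"
  proof
    show "sets Y \<subseteq> sigma_sets (space Y) A"
      unfolding G(2) using A(2) by (intro sigma_sets_mono') auto
    show "sigma_sets (space Y) A \<subseteq> sets Y"
      using A(3) by (rule sets.sigma_sets_subset)
  qed
  define a where "a = from_nat_into A"
  have ra: "range a = A" unfolding a_def using A by (intro range_from_nat_into) auto
  have a[measurable]: "a j \<in> sets Y" for j using ra A(3) by blast
  \<comment> \<open>The integral over \<open>a j\<close> of the derivative minus \<open>q\<close>,
    written without the derivative and hence visibly measurable in \<open>x\<close>.\<close>
  define s where "s q j x = measure (\<kappa> x) (a j) - q * measure (\<mu> x) (a j)" for q :: real and j x
  have [measurable]: "s q j \<in> borel_measurable X" for q j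
    unfolding s_def measure_def using kernelD(3)[OF \<mu>(1) a] kernelD(3)[OF \<kappa>(1) a] by measurable
  \<comment> \<open>Taking the first admissible index is a measurable choice, as the condition
    involves countably many measurable functions of \<open>x\<close>.\<close>
  define N where "N q k x = (LEAST j. \<forall>i. s q i x < s q j x + (1/2)^k)" for q k x
  have N_measurable[measurable]: "N q k \<in> measurable X (count_space UNIV)" for q k
    unfolding N_def by measurable
  have N: "s q i x < s q (N q k x) x + (1/2)^k" if x: "x \<in> space X" and q: "q > 0" for q k x i
  proof -
    interpret \<kappa>: finite_measure "\<kappa> x" by (rule \<kappa>(2)[OF x])
    \<comment> \<open>Since \<open>q > 0\<close>, the total mass of \<open>\<kappa> x\<close> bounds
      all values; the supremum is finite, so a near-optimal index exists.\<close>
    have "s q j x \<le> measure (\<kappa> x) (space (\<kappa> x))" for j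
      using \<kappa>.bounded_measure[of "a j"] mult_nonneg_nonneg[of q "measure (\<mu> x) (a j)"] q
      unfolding s_def by (smt (verit) measure_nonneg)
    then have bdd: "bdd_above (range (\<lambda>j. s q j x))" by (auto intro!: bdd_aboveI)
    have "(SUP j. s q j x) - (1/2)^k < (SUP j. s q j x)" by simp
    then obtain j where j: "(SUP j. s q j x) - (1/2)^k < s q j x"
      using less_cSUP_iff[OF _ bdd] by blast
    have "\<forall>i. s q i x < s q j x + (1/2)^k"
    proof
      fix i show "s q i x < s q j x + (1/2)^k" using cSUP_upper[OF _ bdd, of i] j by simp
    qed
    then show ?thesis
      unfolding N_def by (rule LeastI2_ex[OF exI]) blast
  qed
  \<comment> \<open>Membership in infinitely many chosen sets. It agrees with \<open>q < h y\<close>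
    wherever membership eventually does.\<close>
  define D where "D q z \<longleftrightarrow> (\<forall>n. \<exists>k. k \<ge> n \<and> snd z \<in> a (N q k (fst z)))" for q and z :: "'a \<times> 'b"
  have [measurable]: "Measurable.pred (X \<Otimes>\<^sub>M Y) (D q)" for q
  proof -
    \<comment> \<open>Splitting by the value of \<open>N\<close> turns sets that vary with
      \<open>x\<close> into countable unions of measurable rectangles.\<close>
    have eq: "snd z \<in> a (N q k (fst z)) \<longleftrightarrow> (\<exists>j. N q k (fst z) = j \<and> snd z \<in> a j)" for z k
      by auto
    show ?thesis unfolding D_def eq by measurable
  qed
  define Q where "Q = {q\<in>\<rat>. q > (0::real)}"
  have Q: "countable Q" unfolding Q_def by (rule countable_subset[OF _ countable_rat]) auto
  \<comment> \<open>A nonnegative function is the supremum of the positive rationals below it; a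
    failed test contributes the least value \<open>0\<close>.\<close>
  define g where "g z = (SUP q\<in>Q. if D q z then ennreal q else 0)" for z
  have g: "g \<in> borel_measurable (X \<Otimes>\<^sub>M Y)"
    unfolding g_def by (intro borel_measurable_SUP Q) measurable
  show ?thesis
  proof (intro bexI[OF _ g] ballI)
    fix x assume x: "x \<in> space X"
    interpret \<mu>: finite_measure "\<mu> x" by (rule \<mu>(2)[OF x])
    interpret \<kappa>: finite_measure "\<kappa> x" by (rule \<kappa>(2)[OF x])
    note sts = kernelD(1,2)[OF \<mu>(1) x] kernelD(1,2)[OF \<kappa>(1) x]
    obtain h0 where h0: "h0 \<in> borel_measurable (\<mu> x)" "density (\<mu> x) h0 = \<kappa> x"
      using \<mu>.Radon_Nikodym[OF ac[OF x]] sts by auto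
    \<comment> \<open>Finiteness of \<open>\<kappa> x\<close> makes \<open>h0\<close> finite almost
      everywhere, so \<open>h\<close> is a real-valued version from which \<open>q\<close> can be
      subtracted.\<close>
    define h where "h y = enn2real (h0 y)" for y
    have [measurable]: "h0 \<in> borel_measurable Y" "h \<in> borel_measurable Y"
      "h \<in> borel_measurable (\<mu> x)"
      using h0(1) unfolding h_def by (auto simp: sts cong: measurable_cong_sets)
    have tot: "(\<integral>\<^sup>+y. h0 y \<partial>\<mu> x) = emeasure (\<kappa> x) (space Y)"
    proof -
      have "emeasure (density (\<mu> x) h0) (space (\<mu> x)) = (\<integral>\<^sup>+y. h0 y \<partial>\<mu> x)"
        by (subst emeasure_density) (use h0 in \<open>auto intro!: nn_integral_cong\<close>)
      then show ?thesis using h0(2) sts by simp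
    qed
    have "AE y in \<mu> x. h0 y \<noteq> \<infinity>"
      by (rule nn_integral_PInf_AE) (use h0 tot in auto)
    then have h0h: "AE y in \<mu> x. h0 y = ennreal (h y)"
      by eventually_elim (auto simp: h_def less_top)
    have \<kappa>h: "\<kappa> x = density (\<mu> x) (\<lambda>y. ennreal (h y))"
      unfolding h0(2)[symmetric] by (rule density_cong) (use h0 h0h in auto)
    have h_nonneg: "h y \<ge> 0" for y by (simp add: h_def)
    have int: "integrable (\<mu> x) h"
    proof (rule integrableI_nonneg)
      have "(\<integral>\<^sup>+y. ennreal (h y) \<partial>\<mu> x) = (\<integral>\<^sup>+y. h0 y \<partial>\<mu> x)"
        by (rule nn_integral_cong_AE) (use h0h in auto)
      then show "(\<integral>\<^sup>+y. ennreal (h y) \<partial>\<mu> x) < \<infinity>" using tot by (simp add: less_top[symmetric])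
    qed (auto simp: h_nonneg)
    \<comment> \<open>This identifies the quantity that selects \<open>N\<close> with the one that
      \<open>AE_near_optimal_sets\<close> optimises.\<close>
    have s_eq: "(LINT y:a j|\<mu> x. h y - q) = s q j x" for j q
    proof -
      have [measurable]: "a j \<in> sets (\<mu> x)" using sts by simp
      have "emeasure (\<kappa> x) (a j) = ennreal (\<integral>y. h y * indicator (a j) y \<partial>\<mu> x)"
      proof -
        have "emeasure (\<kappa> x) (a j) = (\<integral>\<^sup>+y. ennreal (h y * indicator (a j) y) \<partial>\<mu> x)"
          unfolding \<kappa>h by (subst emeasure_density) (auto simp: ennreal_mult'[OF h_nonneg] ennreal_indicator)
        also have "\<dots> = ennreal (\<integral>y. h y * indicator (a j) y \<partial>\<mu> x)"
          by (intro nn_integral_eq_integral integrable_real_mult_indicator int)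
            (auto simp: h_nonneg)
        finally show ?thesis .
      qed
      then have "measure (\<kappa> x) (a j) = (LINT y:a j|\<mu> x. h y)"
        by (simp add: measure_def h_nonneg set_lebesgue_integral_def mult.commute)
      moreover have "(LINT y:a j|\<mu> x. h y - q) = (LINT y:a j|\<mu> x. h y) - (LINT y:a j|\<mu> x. q)"
        unfolding set_lebesgue_integral_def scaleR_diff_right
        by (intro Bochner_Integration.integral_diff integrable_mult_indicator int) auto
      ultimately show ?thesis by (simp add: s_def set_lebesgue_integral_def mult.commute)
    qed
    have "AE y in \<mu> x. h y \<noteq> q \<longrightarrow> (\<forall>\<^sub>F k in sequentially. y \<in> a (N q k x) \<longleftrightarrow> q < h y)"
      if "q \<in> Q" for q
      using that N[OF x] sts genA A(2) Un Diff
      by (intro \<mu>.AE_near_optimal_sets[of h a "\<lambda>k. a (N q k x)" q, OF int])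
        (auto simp: ra s_eq Q_def)
    then have "AE y in \<mu> x. \<forall>q\<in>Q. h y \<noteq> q \<longrightarrow>
        (\<forall>\<^sub>F k in sequentially. y \<in> a (N q k x) \<longleftrightarrow> q < h y)"
      using Q by (simp add: AE_ball_countable)
    then have "AE y in \<mu> x. g (x, y) = ennreal (h y)"
    proof eventually_elim
      case (elim y)
      have D: "D q (x, y) \<longleftrightarrow> q < h y" if "q \<in> Q" "h y \<noteq> q" for q
        using elim that unfolding D_def eventually_sequentially
        by simp (meson linear order_refl)
      show ?case
      proof (rule antisym)
        show "g (x, y) \<le> ennreal (h y)"
          unfolding g_def
        proof (rule SUP_least)
          fix q assume "q \<in> Q"
          \<comment> \<open>If \<open>h y = q\<close>, nothing is known about
            \<open>D q (x, y)\<close>, but the bound holds either way.\<close>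
          then show "(if D q (x, y) then ennreal q else 0) \<le> ennreal (h y)"
            using D[of q] by (cases "h y = q") (auto simp: h_nonneg intro!: ennreal_leI)
        qed
        show "ennreal (h y) \<le> g (x, y)"
        proof (rule dense_le)
          fix z assume z: "z < ennreal (h y)"
          then obtain r where r: "z = ennreal r" "0 \<le> r" by (cases z) auto
          with z have "r < h y" by (simp add: ennreal_less_iff)
          then obtain q where q: "q \<in> \<rat>" "r < q" "q < h y" using Rats_dense_in_real by blast
          with r have qQ: "q \<in> Q" by (simp add: Q_def)
          then have "(if D q (x, y) then ennreal q else 0) \<le> g (x, y)"
            unfolding g_def by (rule SUP_upper)
          moreover have "D q (x, y)" using D[OF qQ] q by simp
          ultimately have "ennreal q \<le> g (x, y)" by simp
          moreover have "z \<le> ennreal q" using r q by (simp add: ennreal_leI)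
          ultimately show "z \<le> g (x, y)" by (rule order_trans[rotated])
        qed
      qed
    qed
    then show "density (\<mu> x) (\<lambda>y. g (x, y)) = \<kappa> x"
      unfolding \<kappa>h using g x
      by (intro density_cong) (auto simp: sts cong: measurable_cong_sets)
  qed
qed

text \<open>Over a countable discrete \<open>X\<close>, any choice of measurable sections is jointly
  measurable, so the classical theorem can be applied point by point.\<close>

lemma pair_Radon_Nikodym_countable:
  assumes X: "countable_discrete X"
    and \<mu>: "kernel X Y \<mu>" "\<And>x. x \<in> space X \<Longrightarrow> finite_measure (\<mu> x)"
    and \<kappa>: "kernel X Y \<kappa>"
    and ac: "\<And>x. x \<in> space X \<Longrightarrow> absolutely_continuous (\<mu> x) (\<kappa> x)"
  shows "\<exists>g\<in>borel_measurable (X \<Otimes>\<^sub>M Y). \<forall>x\<in>space X. density (\<mu> x) (\<lambda>y. g (x, y)) = \<kappa> x"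
proof -
  have "\<exists>g\<in>borel_measurable Y. density (\<mu> x) g = \<kappa> x" if x: "x \<in> space X" for x
  proof -
    interpret finite_measure "\<mu> x" by (rule \<mu>(2)[OF x])
    show ?thesis
      using Radon_Nikodym[OF ac[OF x]] kernelD(1)[OF \<mu>(1) x] kernelD(1)[OF \<kappa> x]
      by (simp cong: measurable_cong_sets)
  qed
  then obtain g where g: "\<And>x. x \<in> space X \<Longrightarrow> g x \<in> borel_measurable Y"
    "\<And>x. x \<in> space X \<Longrightarrow> density (\<mu> x) (g x) = \<kappa> x" by metis
  have "(\<lambda>(x, y). g x y) \<in> borel_measurable (count_space (space X) \<Otimes>\<^sub>M Y)"
    using X g(1) by (intro measurable_pair_measure_countable1) (auto simp: countable_discrete_def)
  moreover have "sets (count_space (space X) \<Otimes>\<^sub>M Y) = sets (X \<Otimes>\<^sub>M Y)"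
    using X by (intro sets_pair_measure_cong) (auto simp: countable_discrete_def)
  ultimately have "(\<lambda>(x, y). g x y) \<in> borel_measurable (X \<Otimes>\<^sub>M Y)"
    by (simp cong: measurable_cong_sets)
  then show ?thesis using g(2) by (intro bexI[of _ "\<lambda>(x, y). g x y"]) auto
qed

section \<open>Countable generation of standard Borel spaces\<close>

text \<open>Balls of radius \<open>1 / Suc n\<close> about a countable dense set form a base, so
  every open set is a countable union of them.\<close>

lemma standard_borel_countably_generated:
  assumes "standard_borel Y"
  obtains G where "countable G" "sets Y = sigma_sets (space Y) G"
proof -
  obtain d where "Metric_space (space Y) d"
    and sep: "separable_space (Metric_space.mtopology (space Y) d)"
    and Y: "sets Y = sigma_sets (space Y) {U. openin (Metric_space.mtopology (space Y) d) U}"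
    using assms by (auto simp: standard_borel_def)
  then interpret Metric_space "space Y" d by simp
  obtain C where C: "countable C" "C \<subseteq> space Y" "mtopology closure_of C = space Y"
    using sep by (auto simp: separable_space_def)
  define G where "G = (\<lambda>(c, n). mball c (1 / real (Suc n))) ` (C \<times> (UNIV :: nat set))"
  have cG: "countable G" unfolding G_def using C by auto
  have "U \<in> sigma_sets (space Y) G" if U: "openin mtopology U" for U
  proof -
    have "U \<subseteq> \<Union>{V\<in>G. V \<subseteq> U}"
    proof
      fix x assume x: "x \<in> U"
      then obtain r where r: "r > 0" "mball x r \<subseteq> U" using U openin_mtopology by metis
      have xY: "x \<in> space Y" using x U openin_mtopology by blast
      \<comment> \<open>Half of \<open>r\<close> leaves room for the triangle inequality: a ball of
        this radius whose centre is this close to \<open>x\<close> stays inside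
        \<open>mball x r\<close>.\<close>
      obtain n where n: "1 / real (Suc n) < r / 2" using r nat_approx_posE by (metis half_gt_zero)
      have "x \<in> mtopology closure_of C" using C xY by simp
      then obtain c where c: "c \<in> C" "c \<in> mball x (1 / real (Suc n))"
        unfolding in_closure_of using xY
        by (metis centre_in_mball_iff openin_mball of_nat_0_less_iff zero_less_Suc
            zero_less_divide_1_iff)
      have "mball c (1 / real (Suc n)) \<subseteq> mball x r"
        using c n xY by (intro mball_subset) (auto simp: commute)
      then have "mball c (1 / real (Suc n)) \<in> {V\<in>G. V \<subseteq> U}"
        using c r by (auto simp: G_def)
      moreover have "x \<in> mball c (1 / real (Suc n))" using c by (simp add: commute)
      ultimately show "x \<in> \<Union>{V\<in>G. V \<subseteq> U}" by blast
    qed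
    then have "U = \<Union>{V\<in>G. V \<subseteq> U}" by blast
    moreover have "\<Union>{V\<in>G. V \<subseteq> U} \<in> sigma_sets (space Y) G"
      using countable_subset[OF _ cG] by (intro sigma_sets_UNION) auto
    ultimately show ?thesis by simp
  qed
  then have "sets Y \<subseteq> sigma_sets (space Y) G" unfolding Y by (intro sigma_sets_mono) auto
  moreover have "sigma_sets (space Y) G \<subseteq> sets Y"
    unfolding Y by (rule sigma_sets_mono') (auto simp: G_def)
  ultimately show thesis using cG that by blast
qed

section \<open>Quotients of densities\<close>

text \<open>It suffices that \<open>h\<close> is \<open>g\<close> times the quotient almost
  everywhere, which is in doubt only where \<open>g\<close> is \<open>0\<close> or
  \<open>\<infinity>\<close>. Absolute continuity gives \<open>h = 0\<close> in the first case; the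
  other condition gives \<open>h \<in> {0, \<infinity>}\<close> in the second, where
  \<open>\<infinity> * h = h\<close>.\<close>

lemma density_quotient:
  assumes fin: "finite_measure M"
    and [measurable]: "g \<in> borel_measurable M" "h \<in> borel_measurable M"
    and ac: "absolutely_continuous (density M g) (density M h)"
    and zi: "\<And>U. zero_infty_set (density M g) U \<Longrightarrow> zero_infty_set (density M h) U"
  shows "density M h = density (density M g) (\<lambda>y. if g y = \<infinity> then h y else h y / g y)"
proof -
  interpret finite_measure M by (rule fin)
  have "{y\<in>space M. g y = 0} \<in> null_sets (density M g)"
    by (simp add: null_sets_density_iff)
  then have "{y\<in>space M. g y = 0} \<in> null_sets (density M h)"
    using ac by (auto simp: absolutely_continuous_def)
  then have zero: "AE y in M. g y = 0 \<longrightarrow> h y = 0"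
    using AE_space by (auto simp: null_sets_density_iff elim: eventually_elim2)
  let ?A = "{y\<in>space M. g y = \<infinity>}"
  have "zero_infty_set (density M g) ?A"
    unfolding zero_infty_set_def
  proof (intro conjI ballI impI)
    fix V assume V: "V \<in> sets (density M g)" "V \<subseteq> ?A"
    then have [measurable]: "V \<in> sets M" by simp
    have "emeasure (density M g) V = (\<integral>\<^sup>+y. \<infinity> * indicator V y \<partial>M)"
      by (subst emeasure_density) (use V in \<open>auto intro!: nn_integral_cong simp: indicator_def\<close>)
    also have "\<dots> = \<infinity> * emeasure M V" by (rule nn_integral_cmult_indicator) simp
    finally show "emeasure (density M g) V \<in> {0, \<infinity>}" by (simp add: ennreal_top_mult)
  qed simp
  then have zih: "zero_infty_set (density M h) ?A" by (rule zi)
  \<comment> \<open>The part with \<open>h \<le> n\<close> has finite mass because \<open>M\<close>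
    is finite; inside a zero-infinity set it must be null. Varying \<open>n\<close> excludes all
    values strictly between \<open>0\<close> and \<open>\<infinity>\<close>.\<close>
  have "AE y in M. g y = \<infinity> \<longrightarrow> h y \<le> of_nat n \<longrightarrow> h y = 0" for n :: nat
  proof -
    let ?V = "{y\<in>space M. g y = \<infinity> \<and> h y \<le> of_nat n}"
    have "emeasure (density M h) ?V \<le> (\<integral>\<^sup>+y. of_nat n * indicator ?V y \<partial>M)"
      by (subst emeasure_density) (auto intro!: nn_integral_mono simp: indicator_def)
    also have "\<dots> = of_nat n * emeasure M ?V" by (rule nn_integral_cmult_indicator) simp
    also have "\<dots> < \<infinity>" by (simp add: ennreal_mult_eq_top_iff less_top[symmetric])
    finally have "emeasure (density M h) ?V \<noteq> \<infinity>" by simp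
    moreover have "?V \<in> sets (density M h)" "?V \<subseteq> ?A" by auto
    ultimately have "?V \<in> null_sets (density M h)"
      using zih unfolding zero_infty_set_def by blast
    then show ?thesis
      using AE_space by (auto simp: null_sets_density_iff elim: eventually_elim2)
  qed
  then have "AE y in M. \<forall>n::nat. g y = \<infinity> \<longrightarrow> h y \<le> of_nat n \<longrightarrow> h y = 0"
    by (subst AE_all_countable) blast
  with zero have "AE y in M. h y = g y * (if g y = \<infinity> then h y else h y / g y)"
  proof eventually_elim
    case (elim y)
    show ?case
    proof (cases "g y = \<infinity>")
      case True
      have "h y = 0 \<or> h y = \<infinity>"
      proof (rule disjCI)
        assume "h y \<noteq> \<infinity>"
        then obtain n :: nat where "h y \<le> of_nat n"
          using ennreal_Ex_less_of_nat[of "h y"] by (auto simp: less_top intro: less_imp_le)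
        then show "h y = 0" using elim True by blast
      qed
      then show ?thesis using True by auto
    next
      case False
      show ?thesis
      proof (cases "g y = 0")
        case True
        then show ?thesis using elim by simp
      next
        case g0: False
        then show ?thesis
          using False mult_divide_eq_ennreal[of "g y" "h y"]
          by (simp add: ennreal_times_divide mult.commute)
      qed
    qed
  qed
  then show ?thesis
    by (subst density_density_eq) (auto intro!: density_cong)
qed

section \<open>Densities of s-finite kernels\<close>

lemma finite_kernelD:
  assumes "finite_kernel X Y k"
  shows "kernel X Y k" "x \<in> space X \<Longrightarrow> finite_measure (k x)"
proof -
  show k: "kernel X Y k" using assms by (simp add: finite_kernel_def)
  assume x: "x \<in> space X"
  have "emeasure (k x) (space Y) \<le> (SUP x\<in>space X. emeasure (k x) (space Y))"
    using x by (rule SUP_upper)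
  also have "\<dots> < \<infinity>" using assms by (simp add: finite_kernel_def)
  finally show "finite_measure (k x)"
    using kernelD(2)[OF k x] by (intro finite_measureI) simp
qed

text \<open>The summands are reweighted: positive weights preserve the common null sets, small
  weights make the total mass finite, and weights measurable in \<open>x\<close> still give a
  kernel.\<close>

lemma s_finite_kernel_equivalent_finite:
  assumes "s_finite_kernel X Y k"
  obtains \<mu> where "kernel X Y \<mu>" "\<And>x. x \<in> space X \<Longrightarrow> finite_measure (\<mu> x)"
    "\<And>x. x \<in> space X \<Longrightarrow> null_sets (\<mu> x) = null_sets (k x)"
proof -
  obtain ki :: "nat \<Rightarrow> _" where k: "kernel X Y k" and ki: "\<And>i. finite_kernel X Y (ki i)"
    and sum: "\<And>x V. x \<in> space X \<Longrightarrow> V \<in> sets Y \<Longrightarrow> emeasure (k x) V = (\<Sum>i. emeasure (ki i x) V)"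
    using assms unfolding s_finite_kernel_def by blast
  note kk = finite_kernelD[OF ki] kernelD[OF finite_kernelD(1)[OF ki]]
  \<comment> \<open>The \<open>1 +\<close> avoids division by zero, finite masses keep the weight
    positive, and the \<open>i\<close>-th summand is left with mass at most
    \<open>(1/2)^i\<close>.\<close>
  define w where "w i x = ennreal ((1/2)^i) / (1 + emeasure (ki i x) (space Y))" for i x
  define \<mu> where "\<mu> x = measure_of (space Y) (sets Y) (\<lambda>V. \<Sum>i. w i x * emeasure (ki i x) V)" for x
  have sets: "sets (\<mu> x) = sets Y" for x by (simp add: \<mu>_def)
  have em: "emeasure (\<mu> x) V = (\<Sum>i. w i x * emeasure (ki i x) V)"
    if x: "x \<in> space X" and V: "V \<in> sets Y" for x V
    unfolding \<mu>_def
  proof (rule emeasure_measure_of_sigma)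
    show "sigma_algebra (space Y) (sets Y)" ..
    show "positive (sets Y) (\<lambda>V. \<Sum>i. w i x * emeasure (ki i x) V)"
      by (simp add: positive_def)
    show "countably_additive (sets Y) (\<lambda>V. \<Sum>i. w i x * emeasure (ki i x) V)"
    proof (rule countably_additiveI)
      fix A :: "nat \<Rightarrow> _" assume A: "range A \<subseteq> sets Y" "disjoint_family A"
      \<comment> \<open>The order of summation is exchanged by reading one sum as an integral
        against counting measure.\<close>
      have "(\<Sum>n. \<Sum>i. w i x * emeasure (ki i x) (A n))
          = (\<integral>\<^sup>+n. (\<Sum>i. w i x * emeasure (ki i x) (A n)) \<partial>count_space UNIV)"
        by (simp only: nn_integral_count_space_nat)
      also have "\<dots> = (\<Sum>i. \<integral>\<^sup>+n. w i x * emeasure (ki i x) (A n) \<partial>count_space UNIV)"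
        by (rule nn_integral_suminf) simp
      also have "\<dots> = (\<Sum>i. \<Sum>n. w i x * emeasure (ki i x) (A n))"
        by (simp only: nn_integral_count_space_nat)
      also have "\<dots> = (\<Sum>i. w i x * emeasure (ki i x) (\<Union>n. A n))"
        using A kk(3)[OF x] by (simp add: suminf_emeasure)
      finally show "(\<Sum>n. \<Sum>i. w i x * emeasure (ki i x) (A n)) = (\<Sum>i. w i x * emeasure (ki i x) (\<Union>n. A n))" .
    qed
  qed (rule V)
  have fin: "emeasure (ki i x) (space Y) < \<infinity>" if "x \<in> space X" for i x
  proof -
    interpret finite_measure "ki i x" by (rule kk(2)[OF that])
    show ?thesis by (simp add: less_top[symmetric])
  qed
  have wpos: "w i x \<noteq> 0" if "x \<in> space X" for i x
    using fin[OF that, of i] by (auto simp: w_def ennreal_divide_eq_0_iff)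
  have wle: "w i x * emeasure (ki i x) (space Y) \<le> ennreal ((1/2)^i)" if x: "x \<in> space X" for i x
  proof -
    let ?e = "emeasure (ki i x) (space Y)"
    have "w i x * ?e \<le> w i x * (1 + ?e)" by (intro mult_left_mono) auto
    also have "\<dots> = ennreal ((1/2)^i)"
      using fin[OF x, of i] mult_divide_eq_ennreal[of "1 + ?e" "ennreal ((1/2)^i)"]
      by (simp add: w_def ennreal_times_divide mult.commute)
    finally show ?thesis .
  qed
  show thesis
  proof
    show "kernel X Y \<mu>"
      unfolding kernel_def
    proof (intro conjI ballI)
      fix V assume V: "V \<in> sets Y"
      have [measurable]: "(\<lambda>x. emeasure (ki i x) V) \<in> borel_measurable X"
        "(\<lambda>x. emeasure (ki i x) (space Y)) \<in> borel_measurable X" for i using kk(5) V by auto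
      have "(\<lambda>x. \<Sum>i. w i x * emeasure (ki i x) V) \<in> borel_measurable X"
        unfolding w_def by measurable
      then show "(\<lambda>x. emeasure (\<mu> x) V) \<in> borel_measurable X"
        by (rule measurable_cong[THEN iffD1, rotated]) (simp add: em[OF _ V])
    qed (rule sets)
    show "finite_measure (\<mu> x)" if x: "x \<in> space X" for x
    proof (rule finite_measureI)
      have "emeasure (\<mu> x) (space Y) \<le> (\<Sum>i. ennreal ((1/2)^i))"
        unfolding em[OF x sets.top] using wle[OF x] by (intro suminf_le) auto
      also have "\<dots> < \<infinity>"
      proof -
        have "summable (\<lambda>i. (1/2)^i :: real)" by (rule summable_geometric) simp
        then have "(\<Sum>i. ennreal ((1/2)^i)) \<noteq> top" by (rule ennreal_suminf_neq_top) simp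
        then show ?thesis by (simp only: less_top infinity_ennreal_def)
      qed
      finally show "emeasure (\<mu> x) (space (\<mu> x)) \<noteq> \<infinity>"
        by (simp add: sets_eq_imp_space_eq[OF sets])
    qed
    show "null_sets (\<mu> x) = null_sets (k x)" if x: "x \<in> space X" for x
    proof -
      have "emeasure (\<mu> x) V = 0 \<longleftrightarrow> emeasure (k x) V = 0" if V: "V \<in> sets Y" for V
        using wpos[OF x] by (simp add: em[OF x V] sum[OF x V] suminf_eq_zero_iff)
      then show ?thesis by (auto simp: null_sets_def sets kernelD(1)[OF k x])
    qed
  qed
qed

lemma density_suminf:
  assumes g[measurable]: "\<And>i. g i \<in> borel_measurable M" and sets: "sets N = sets M"
    and N: "\<And>V. V \<in> sets M \<Longrightarrow> emeasure N V = (\<Sum>i. emeasure (density M (g i)) V)"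
  shows "N = density M (\<lambda>y. \<Sum>i. g i y)"
proof (rule measure_eqI)
  show "sets N = sets (density M (\<lambda>y. \<Sum>i. g i y))" by (simp add: sets)
  fix V assume "V \<in> sets N"
  then have V[measurable]: "V \<in> sets M" by (simp add: sets)
  have "emeasure N V = (\<Sum>i. \<integral>\<^sup>+y. g i y * indicator V y \<partial>M)"
    by (simp add: N emeasure_density)
  also have "\<dots> = (\<integral>\<^sup>+y. (\<Sum>i. g i y * indicator V y) \<partial>M)"
    by (rule nn_integral_suminf[symmetric]) measurable
  also have "\<dots> = emeasure (density M (\<lambda>y. \<Sum>i. g i y)) V"
    by (simp add: emeasure_density)
  finally show "emeasure N V = emeasure (density M (\<lambda>y. \<Sum>i. g i y)) V" .
qed

text \<open>A null set of a sum is null for every summand, so each finite summand has a derivative;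
  these derivatives add up, possibly to \<open>\<infinity>\<close>.\<close>

lemma s_finite_kernel_density:
  assumes k: "s_finite_kernel X Y k"
    and \<mu>: "kernel X Y \<mu>" "\<And>x. x \<in> space X \<Longrightarrow> finite_measure (\<mu> x)"
    and ac: "\<And>x. x \<in> space X \<Longrightarrow> absolutely_continuous (\<mu> x) (k x)"
    and Y: "countable_discrete X \<or> (\<exists>G. countable G \<and> sets Y = sigma_sets (space Y) G)"
  shows "\<exists>g\<in>borel_measurable (X \<Otimes>\<^sub>M Y). \<forall>x\<in>space X. k x = density (\<mu> x) (\<lambda>y. g (x, y))"
proof -
  obtain ki :: "nat \<Rightarrow> _" where k': "kernel X Y k" and ki: "\<And>i. finite_kernel X Y (ki i)"
    and sum: "\<And>x V. x \<in> space X \<Longrightarrow> V \<in> sets Y \<Longrightarrow> emeasure (k x) V = (\<Sum>i. emeasure (ki i x) V)"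
    using k unfolding s_finite_kernel_def by blast
  note kk = finite_kernelD[OF ki] kernelD[OF finite_kernelD(1)[OF ki]]
  have aci: "absolutely_continuous (\<mu> x) (ki i x)" if x: "x \<in> space X" for x i
    unfolding absolutely_continuous_def
  proof
    fix V assume "V \<in> null_sets (\<mu> x)"
    then have "V \<in> null_sets (k x)" using ac[OF x] by (auto simp: absolutely_continuous_def)
    then have V: "V \<in> sets Y" "emeasure (k x) V = 0"
      using kernelD(1)[OF k' x] by auto
    then have "(\<Sum>i. emeasure (ki i x) V) = 0" using sum[OF x V(1)] by simp
    with V show "V \<in> null_sets (ki i x)"
      using kk(3)[OF x] by (auto simp: suminf_eq_zero_iff)
  qed
  have "\<exists>g\<in>borel_measurable (X \<Otimes>\<^sub>M Y). \<forall>x\<in>space X. density (\<mu> x) (\<lambda>y. g (x, y)) = ki i x" for i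
    using Y
  proof
    assume "countable_discrete X"
    then show ?thesis by (rule pair_Radon_Nikodym_countable) (use \<mu> kk aci in auto)
  next
    assume "\<exists>G. countable G \<and> sets Y = sigma_sets (space Y) G"
    then obtain G where "countable G" "sets Y = sigma_sets (space Y) G" by blast
    then show ?thesis
      by (rule pair_Radon_Nikodym_countably_generated) (use \<mu> kk aci in auto)
  qed
  then obtain g where g[measurable]: "\<And>i. g i \<in> borel_measurable (X \<Otimes>\<^sub>M Y)"
    and gd: "\<And>i x. x \<in> space X \<Longrightarrow> density (\<mu> x) (\<lambda>y. g i (x, y)) = ki i x" by metis
  show ?thesis
  proof (intro bexI[of _ "\<lambda>z. \<Sum>i. g i z"] ballI)
    fix x assume x: "x \<in> space X"
    note sts = kernelD(1)[OF \<mu>(1) x] kernelD(1)[OF k' x]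
    have "(\<lambda>y. g i (x, y)) \<in> borel_measurable Y" for i using x by measurable
    then show "k x = density (\<mu> x) (\<lambda>y. \<Sum>i. g i (x, y))"
      by (intro density_suminf) (auto simp: sts gd x sum cong: measurable_cong_sets)
  qed measurable
qed

text \<open>A reference \<open>\<mu>\<close> built from \<open>\<nu>\<close> alone serves both
  kernels: every \<open>\<mu>\<close>-null set is \<open>\<nu>\<close>-null, hence
  \<open>\<nu>'\<close>-null. The quotient of the two densities inherits their joint
  measurability.\<close>

lemma s_finite_kernel_Radon_Nikodym:
  assumes \<nu>: "s_finite_kernel X Y \<nu>" and \<nu>': "s_finite_kernel X Y \<nu>'"
    and ac: "kernel_infty_ac X \<nu>' \<nu>"
    and Y: "countable_discrete X \<or> (\<exists>G. countable G \<and> sets Y = sigma_sets (space Y) G)"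
  shows "\<exists>f\<in>borel_measurable (X \<Otimes>\<^sub>M Y). \<forall>x\<in>space X. \<nu>' x = kernel_density \<nu> f x"
proof -
  obtain \<mu> where \<mu>: "kernel X Y \<mu>" "\<And>x. x \<in> space X \<Longrightarrow> finite_measure (\<mu> x)"
    and null: "\<And>x. x \<in> space X \<Longrightarrow> null_sets (\<mu> x) = null_sets (\<nu> x)"
    using s_finite_kernel_equivalent_finite[OF \<nu>] by blast
  have ac': "absolutely_continuous (\<nu> x) (\<nu>' x)"
    "zero_infty_set (\<nu> x) U \<Longrightarrow> zero_infty_set (\<nu>' x) U" if "x \<in> space X" for x U
    using ac that by (auto simp: kernel_infty_ac_def kernel_ac_def)
  obtain g where g[measurable]: "g \<in> borel_measurable (X \<Otimes>\<^sub>M Y)"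
    and gd: "\<And>x. x \<in> space X \<Longrightarrow> \<nu> x = density (\<mu> x) (\<lambda>y. g (x, y))"
    using s_finite_kernel_density[OF \<nu> \<mu> _ Y] null by (auto simp: absolutely_continuous_def)
  obtain h where h[measurable]: "h \<in> borel_measurable (X \<Otimes>\<^sub>M Y)"
    and hd: "\<And>x. x \<in> space X \<Longrightarrow> \<nu>' x = density (\<mu> x) (\<lambda>y. h (x, y))"
    using s_finite_kernel_density[OF \<nu>' \<mu> _ Y] null ac'(1) by (auto simp: absolutely_continuous_def)
  show ?thesis
  proof (intro bexI[of _ "\<lambda>z. if g z = \<infinity> then h z else h z / g z"] ballI)
    fix x assume x: "x \<in> space X"
    have m: "(\<lambda>y. g (x, y)) \<in> borel_measurable (\<mu> x)" "(\<lambda>y. h (x, y)) \<in> borel_measurable (\<mu> x)"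
      using x kernelD(1)[OF \<mu>(1) x] by (auto cong: measurable_cong_sets)
    show "\<nu>' x = kernel_density \<nu> (\<lambda>z. if g z = \<infinity> then h z else h z / g z) x"
      using density_quotient[OF \<mu>(2)[OF x] m] ac'[OF x] x
      by (simp add: kernel_density_def gd hd)
  qed measurable
qed

text \<open>This permits replacing \<open>X\<close> by one of its points, a countable discrete
  space, when a single fibre is studied.\<close>

lemma s_finite_kernel_singleton:
  assumes k: "s_finite_kernel X Y k" and x: "x \<in> space X"
  shows "s_finite_kernel (count_space {x}) Y k"
proof -
  have fin: "finite_kernel (count_space {x}) Y l" if "finite_kernel X Y l" for l
  proof -
    interpret finite_measure "l x" using finite_kernelD(2)[OF that x] .
    show ?thesis
      using kernelD[OF finite_kernelD(1)[OF that]] x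
      by (auto simp: finite_kernel_def kernel_def less_top[symmetric])
  qed
  have "kernel (count_space {x}) Y k" using k x by (auto simp: s_finite_kernel_def kernel_def)
  then show ?thesis using k x fin by (fastforce simp: s_finite_kernel_def)
qed

section \<open>Failure under mere absolute continuity\<close>

text \<open>A density against an atom of infinite mass yields only the masses \<open>0\<close> and
  \<open>\<infinity>\<close>, never \<open>1\<close>. Absolute continuity holds because only the
  empty set is null for \<open>\<nu>\<close>.\<close>

lemma infinite_atom_counterexample:
  defines "X \<equiv> count_space {0::real}" and "Y \<equiv> count_space {0::real}"
    and "\<nu> \<equiv> \<lambda>_::real. density (count_space {0::real}) (\<lambda>_. \<infinity>)"
    and "\<nu>' \<equiv> \<lambda>_::real. count_space {0::real}"
  shows "s_finite_kernel X Y \<nu>" "s_finite_kernel X Y \<nu>'" "kernel_ac X \<nu>' \<nu>"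
    "\<nu>' 0 \<noteq> kernel_density \<nu> f 0"
proof -
  have em: "emeasure (density (count_space {0::real}) (\<lambda>_. c)) V = c * (if 0 \<in> V then 1 else 0)"
    if "V \<subseteq> {0}" for V and c :: ennreal
    using that by (subst emeasure_density) (auto simp: nn_integral_count_space_finite indicator_def)
  have em1: "emeasure (count_space {0::real}) V = (if 0 \<in> V then 1 else 0)" if "V \<subseteq> {0}" for V
    using that by (cases "V = {}") (auto simp: subset_singleton_iff)
  have fin: "finite_kernel X Y (\<lambda>_. density (count_space {0}) (\<lambda>_. c))" if "c < \<infinity>" for c
    using that by (auto simp: finite_kernel_def kernel_def X_def Y_def em)
  \<comment> \<open>The infinite atom is a sum of countably many unit atoms.\<close>
  have "(\<Sum>i::nat. 1::ennreal) = \<infinity>"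
    using summable_suminf_not_top[of "\<lambda>_. 1::real"] by (auto simp: summable_const_iff)
  then show "s_finite_kernel X Y \<nu>"
    unfolding s_finite_kernel_def
    by (intro conjI exI[of _ "\<lambda>_ _. density (count_space {0}) (\<lambda>_. 1)"] allI fin)
      (auto simp: \<nu>_def kernel_def X_def Y_def em)
  have "(\<Sum>i::nat. if i = 0 then 1 else 0 :: ennreal) = 1"
    by (subst suminf_finite[of "{0}"]) auto
  then show "s_finite_kernel X Y \<nu>'"
    unfolding s_finite_kernel_def
    by (intro conjI exI[of _ "\<lambda>i _. density (count_space {0}) (\<lambda>_. if i = 0 then 1 else 0)"] allI fin)
      (auto simp: \<nu>'_def kernel_def X_def Y_def em em1)
  show "kernel_ac X \<nu>' \<nu>"
    by (auto simp: kernel_ac_def absolutely_continuous_def \<nu>_def \<nu>'_def null_sets_def em em1 split: if_splits)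
  show "\<nu>' 0 \<noteq> kernel_density \<nu> f 0"
  proof
    assume "\<nu>' 0 = kernel_density \<nu> f 0"
    then have "emeasure (\<nu>' 0) {0} = emeasure (kernel_density \<nu> f 0) {0}" by simp
    also have "\<dots> = \<infinity> * f (0, 0)"
      by (simp add: kernel_density_def \<nu>_def density_density_eq emeasure_density nn_integral_count_space_finite)
    finally show False by (simp add: \<nu>'_def ennreal_top_mult split: if_splits)
  qed
qed

section \<open>Sectionwise and jointly measurable densities between s-finite kernels\<close>

theorem theorem10:
  shows "(\<forall>(X :: 'a measure) (Y :: 'b measure) \<nu> \<nu>'.
            s_finite_kernel X Y \<nu> \<and> s_finite_kernel X Y \<nu>' \<and> kernel_infty_ac X \<nu>' \<nu> \<longrightarrow>
              (\<exists>f :: 'a \<times> 'b \<Rightarrow> ennreal.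
                 (\<forall>x\<in>space X. (\<lambda>y. f (x, y)) \<in> borel_measurable Y) \<and>
                 (\<forall>x\<in>space X. \<nu>' x = kernel_density \<nu> f x)) \<and>
              (countable_discrete X \<or> standard_borel Y \<longrightarrow>
                (\<exists>f :: 'a \<times> 'b \<Rightarrow> ennreal.
                   f \<in> borel_measurable (X \<Otimes>\<^sub>M Y) \<and>
                   (\<forall>x\<in>space X. (\<lambda>y. f (x, y)) \<in> borel_measurable Y) \<and>
                   (\<forall>x\<in>space X. \<nu>' x = kernel_density \<nu> f x)))) \<and>
         (\<exists>(X :: real measure) (Y :: real measure) \<nu> \<nu>'.
            s_finite_kernel X Y \<nu> \<and> s_finite_kernel X Y \<nu>' \<and> kernel_ac X \<nu>' \<nu> \<and>
            \<not> (\<exists>f :: real \<times> real \<Rightarrow> ennreal.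
                 (\<forall>x\<in>space X. (\<lambda>y. f (x, y)) \<in> borel_measurable Y) \<and>
                 (\<forall>x\<in>space X. \<nu>' x = kernel_density \<nu> f x)))"
proof (intro conjI allI impI)
  fix X :: "'a measure" and Y :: "'b measure" and \<nu> \<nu>'
  assume asm: "s_finite_kernel X Y \<nu> \<and> s_finite_kernel X Y \<nu>' \<and> kernel_infty_ac X \<nu>' \<nu>"
  \<comment> \<open>Each fibre is handled over a one-point source, and the derivatives are then
    glued by choice, with no claim of measurability in \<open>x\<close>.\<close>
  have "\<exists>f. f \<in> borel_measurable Y \<and> \<nu>' x = density (\<nu> x) f" if x: "x \<in> space X" for x
  proof -
    let ?X = "count_space {x}"
    have "kernel_infty_ac ?X \<nu>' \<nu>"
      using asm x by (auto simp: kernel_infty_ac_def kernel_ac_def)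
    moreover have "countable_discrete ?X" by (simp add: countable_discrete_def)
    ultimately obtain f where [measurable]: "f \<in> borel_measurable (?X \<Otimes>\<^sub>M Y)"
      and f: "\<nu>' x = kernel_density \<nu> f x"
      using s_finite_kernel_Radon_Nikodym[of ?X Y \<nu> \<nu>'] asm x s_finite_kernel_singleton by force
    have "(\<lambda>y. f (x, y)) \<in> borel_measurable Y" by measurable
    then show ?thesis using f unfolding kernel_density_def by blast
  qed
  then obtain f where "\<And>x. x \<in> space X \<Longrightarrow> f x \<in> borel_measurable Y \<and> \<nu>' x = density (\<nu> x) (f x)"
    by metis
  then show "\<exists>f. (\<forall>x\<in>space X. (\<lambda>y. f (x, y)) \<in> borel_measurable Y) \<and>
      (\<forall>x\<in>space X. \<nu>' x = kernel_density \<nu> f x)"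
    by (intro exI[of _ "\<lambda>(x, y). f x y"]) (auto simp: kernel_density_def)
  assume "countable_discrete X \<or> standard_borel Y"
  then have "countable_discrete X \<or> (\<exists>G. countable G \<and> sets Y = sigma_sets (space Y) G)"
    using standard_borel_countably_generated by metis
  then obtain f where f[measurable]: "f \<in> borel_measurable (X \<Otimes>\<^sub>M Y)"
    and "\<forall>x\<in>space X. \<nu>' x = kernel_density \<nu> f x"
    using s_finite_kernel_Radon_Nikodym[of X Y \<nu> \<nu>'] asm by blast
  moreover have "\<forall>x\<in>space X. (\<lambda>y. f (x, y)) \<in> borel_measurable Y" by measurable
  ultimately show "\<exists>f. f \<in> borel_measurable (X \<Otimes>\<^sub>M Y) \<and>
      (\<forall>x\<in>space X. (\<lambda>y. f (x, y)) \<in> borel_measurable Y) \<and>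
      (\<forall>x\<in>space X. \<nu>' x = kernel_density \<nu> f x)" by blast
next
  show "\<exists>(X :: real measure) (Y :: real measure) \<nu> \<nu>'.
      s_finite_kernel X Y \<nu> \<and> s_finite_kernel X Y \<nu>' \<and> kernel_ac X \<nu>' \<nu> \<and>
      \<not> (\<exists>f :: real \<times> real \<Rightarrow> ennreal.
           (\<forall>x\<in>space X. (\<lambda>y. f (x, y)) \<in> borel_measurable Y) \<and>
           (\<forall>x\<in>space X. \<nu>' x = kernel_density \<nu> f x))"
    using infinite_atom_counterexample by fastforce
qed

end
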